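(* Let $\overline{N}(m,n)$ denote the number of overpartitions of $n$ with $D$-rank $m$, and let $\overline{N2}(m,n)$ denote the number of overpartitions of $n$ with $M_2$-rank $m$. Then for all integers $m,n\geq 0$, $$\overline{N}(m,n)\geq \overline{N}(m+2,n)\quad\text{and}\quad \overline{N2}(m,n)\geq \overline{N2}(m+2,n).$$
   Context: An overpartition of a nonnegative integer $n$ is a partition of $n$ (a weakly decreasing finite sequence of positive integers summing to $n$) in which the first occurrence of each distinct part value may (or may not) be overlined. For an overpartition $\lambda$, let $\lambda_1$ be its largest part (taken to be $0$ for the empty overpartition) and $\ell(\lambda)$ its number of parts. The $D$-rank of $\lambda$ is $\lambda_1-\ell(\lambda)$. Let $\lambda_o$ denote the partition consisting of the non-overlined odd parts of $\lambda$, and let $\chi(\lambda)=1$ if the largest part of $\lambda$ is odd and non-overlined, and $\chi(\lambda)=0$ otherwise. The $M_2$-rank of $\lambda$ is $\lfloor \lambda_1/2\rfloor-\ell(\lambda)+\ell(\lambda_o)-\chi(\lambda)$. Equivalently, with $(a;q)_k=\prod_{i=0}^{k-1}(1-aq^i)$, $$\sum_{n\ge0}\sum_{m\in\mathbb{Z}}\overline{N}(m,n)z^mq^n=\sum_{k\ge0}\frac{(-1;q)_k q^{k(k+1)/2}}{(zq;q)_k(q/z;q)_k},\qquad \sum_{n\ge0}\sum_{m\in\mathbb{Z}}\overline{N2}(m,n)z^mq^n=\sum_{k\ge0}\frac{(-1;q)_{2k} q^{k}}{(zq^2;q^2)_k(q^2/z;q^2)_k}.$$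
   Formalization: The M_2-rank is taken with the ceiling of λ_1/2 instead of the floor, since only the ceiling agrees with the stated generating function (its q-coefficient is 2z^0, while the floor gives both overpartitions of 1 rank -1). *)

theory Defs
  imports Complex_Main
begin

text \<open>
  An overpartition is the list of its parts in weakly decreasing order; a part is a pair of its
  size and a flag telling whether it is overlined. Only the first occurrence of a size may carry
  the flag.
\<close>

type_synonym overpartition = "(nat \<times> bool) list"

definition overpartition_of :: "nat \<Rightarrow> overpartition \<Rightarrow> bool" where
  "overpartition_of n ps \<longleftrightarrow>
     sorted_wrt (\<ge>) (map fst ps) \<and>
     (\<forall>p \<in> set ps. fst p > 0) \<and>
     (\<forall>i < length ps. snd (ps ! i) \<longrightarrow> (\<forall>j < i. fst (ps ! j) \<noteq> fst (ps ! i))) \<and>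
     sum_list (map fst ps) = n"

definition largest_part :: "overpartition \<Rightarrow> nat" where
  "largest_part ps = (if ps = [] then 0 else fst (hd ps))"

definition D_rank :: "overpartition \<Rightarrow> int" where
  "D_rank ps = int (largest_part ps) - int (length ps)"

definition nonoverlined_odd_parts :: "overpartition \<Rightarrow> nat list" where
  "nonoverlined_odd_parts ps = map fst (filter (\<lambda>p. odd (fst p) \<and> \<not> snd p) ps)"

definition chi :: "overpartition \<Rightarrow> int" where
  "chi ps = (if ps \<noteq> [] \<and> odd (fst (hd ps)) \<and> \<not> snd (hd ps) then 1 else 0)"

text \<open>
  The first summand is half the largest part rounded up, as in Lovejoy's definition of the
  \<open>M\<^sub>2\<close>-rank. Rounding up is what the generating function
  \<open>\<Sum>\<^sub>k (-1;q)\<^sub>2\<^sub>k q\<^sup>k / ((zq\<^sup>2;q\<^sup>2)\<^sub>k (q\<^sup>2/z;q\<^sup>2)\<^sub>k)\<close> forces: its coefficient of \<open>q\<close> is \<open>2z\<^sup>0\<close>, so both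
  overpartitions of 1 must have rank 0, whereas rounding down would give both of them rank -1.
\<close>

definition M2_rank :: "overpartition \<Rightarrow> int" where
  "M2_rank ps = \<lceil>real (largest_part ps) / 2\<rceil> - int (length ps)
     + int (length (nonoverlined_odd_parts ps)) - chi ps"

definition N_bar :: "int \<Rightarrow> nat \<Rightarrow> nat" where
  "N_bar m n = card {ps. overpartition_of n ps \<and> D_rank ps = m}"

definition N2_bar :: "int \<Rightarrow> nat \<Rightarrow> nat" where
  "N2_bar m n = card {ps. overpartition_of n ps \<and> M2_rank ps = m}"

lemma finite_overpartitions: "finite {ps. overpartition_of n ps}"
proof (rule finite_subset)
  show "{ps. overpartition_of n ps} \<subseteq> {ps. set ps \<subseteq> {..n} \<times> UNIV \<and> length ps \<le> n}"
  proof (rule subsetI)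
    fix ps assume "ps \<in> {ps. overpartition_of n ps}"
    then have pos: "\<forall>x \<in> set (map fst ps). 1 \<le> x" and sum: "sum_list (map fst ps) = n"
      by (auto simp: overpartition_of_def Suc_le_eq)
    have "length xs \<le> sum_list xs" if "\<forall>x \<in> set xs. 1 \<le> x" for xs :: "nat list"
      using that by (induction xs) auto
    from this[OF pos] have len: "length ps \<le> n" using sum by simp
    have "a \<le> n" if "a \<in> set (map fst ps)" for a
      using that sum member_le_sum_list[of a "map fst ps"] by simp
    then have "set ps \<subseteq> {..n} \<times> UNIV" by force
    with len show "ps \<in> {ps. set ps \<subseteq> {..n} \<times> UNIV \<and> length ps \<le> n}" by simp
  qed
  show "finite {ps :: overpartition. set ps \<subseteq> {..n} \<times> UNIV \<and> length ps \<le> n}"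
    by (rule finite_lists_length_le) simp
qed

end

theory Submission
  imports Defs "HOL-Computational_Algebra.Formal_Laurent_Series"
begin

text \<open>
  The characters \<open>\<chi>\<^sub>n = z\<^sup>n + z\<^bsup>n-2\<^esup> + \<dots> + z\<^bsup>-n\<^esup>\<close> of \<open>SL\<^sub>2\<close> span a cone that is closed under
  multiplication (Clebsch-Gordan), and the coefficients \<open>f\<^sub>m\<close> of each of its elements satisfy
  \<open>f\<^sub>m \<ge> f\<^bsub>m+2\<^esub>\<close> for \<open>m \<ge> 0\<close>. Since \<open>1/((1 - zu)(1 - u/z)) = \<Sum>\<^sub>n \<chi>\<^sub>n u\<^sup>n\<close>, both rank generating functions
  have all their \<open>q\<close>-coefficients in the cone once they are written as
  \<open>\<Sum>\<^sub>k (-1;q)\<^sub>k q\<^bsup>k(k+1)/2\<^esup> / ((zq;q)\<^sub>k (q/z;q)\<^sub>k)\<close> and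
  \<open>\<Sum>\<^sub>k (-1;q)\<^sub>2\<^sub>k q\<^sup>k / ((zq\<^sup>2;q\<^sup>2)\<^sub>k (q\<^sup>2/z;q\<^sup>2)\<^sub>k)\<close>.

  Sorting overpartitions by a level (for the \<open>D\<close>-rank, the largest part) gives the generating
  function in the form \<open>\<Sum>\<^sub>N z\<^sup>N (B\<^sub>N - B\<^bsub>N-1\<^esub>)\<close>, where
  \<open>B\<^sub>N = (-xQ;Q)\<^sub>N (-\<alpha>x;Q)\<^sub>N / ((xQ;Q)\<^sub>N (\<alpha>;Q)\<^bsub>N+1\<^esub>)\<close> with \<open>x = 1/z\<close>, and \<open>(Q, \<alpha>)\<close> is \<open>(q, 0)\<close> for the
  \<open>D\<close>-rank and \<open>(q\<^sup>2, q)\<close> for the \<open>M\<^sub>2\<close>-rank. This sum is \<open>L\<^sub>0\<close> for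
  \<open>L\<^sub>k = (1 - zQ\<^sup>k) \<Sum>\<^sub>N (zQ\<^sup>k)\<^sup>N (-xQ;Q)\<^sub>N (-\<alpha>x;Q)\<^sub>N / ((xQ\<^bsup>k+1\<^esup>;Q)\<^sub>N (\<alpha>;Q)\<^bsub>N+1\<^esub>)\<close>, and a telescoping sum
  shows \<open>L\<^sub>k = 1 + c\<^sub>k L\<^bsub>k+1\<^esub>\<close> with
  \<open>c\<^sub>k = (1 + Q\<^sup>k)(\<alpha> + Q\<^bsup>k+1\<^esup>) / ((1 - zQ\<^bsup>k+1\<^esup>)(1 - xQ\<^bsup>k+1\<^esup>))\<close>. As \<open>q\<close> divides \<open>c\<^sub>k\<close>, iterating the
  recurrence produces the series above.
\<close>

unbundle fps_syntax

section \<open>The cone spanned by the characters of SL_2\<close>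

locale unit_pair =
  fixes z x :: "'a::field"
  assumes zx: "z * x = 1"
begin

primrec sl2_char :: "nat \<Rightarrow> 'a" where
  "sl2_char 0 = 1"
| "sl2_char (Suc n) = z * sl2_char n + x ^ Suc n"

text \<open>In \<open>sl2_char 1\<close> = z + x the summand z raises the index and leaves -x^(n+2),
  the summand x lowers it and leaves +x^(n+2).\<close>

lemma sl2_char_1_mult: "sl2_char 1 * sl2_char (Suc n) = sl2_char (Suc (Suc n)) + sl2_char n"
proof -
  have "x * (z * sl2_char n) = sl2_char n" using zx by (simp add: mult.assoc[symmetric] mult.commute[of x z])
  then show ?thesis by (simp add: algebra_simps)
qed

text \<open>For fixed n both sides obey the recurrence of \<open>sl2_char_1_mult\<close> in m, so m
  = 0 and m = 1 suffice. Splitting off only the top character lets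
  \<open>sl2_char_mult_in_cone\<close> proceed by induction.\<close>

lemma clebsch_gordan: "sl2_char (Suc m) * sl2_char (Suc n) = sl2_char (Suc (Suc (m + n))) + sl2_char m * sl2_char n"
proof (induction m rule: less_induct)
  case (less m)
  have rec: "sl2_char (Suc (Suc k)) = sl2_char 1 * sl2_char (Suc k) - sl2_char k" for k
    using sl2_char_1_mult[of k] by simp
  consider "m = 0" | "m = 1" | k where "m = Suc (Suc k)"
    by (metis One_nat_def not0_implies_Suc)
  then show ?case
  proof cases
    case 1
    then show ?thesis using sl2_char_1_mult[of n] by (simp del: sl2_char.simps(2) flip: One_nat_def)
  next
    case 2
    have "sl2_char (Suc m) * sl2_char (Suc n) = (sl2_char 1 * sl2_char 1 - 1) * sl2_char (Suc n)"
      using 2 rec[of 0] by (simp del: sl2_char.simps(2))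
    also have "\<dots> = sl2_char 1 * (sl2_char 1 * sl2_char (Suc n)) - sl2_char (Suc n)" by (simp add: algebra_simps)
    also have "\<dots> = sl2_char 1 * (sl2_char (Suc (Suc n)) + sl2_char n) - sl2_char (Suc n)"
      using sl2_char_1_mult[of n] by simp
    also have "\<dots> = sl2_char (Suc (Suc (Suc n))) + sl2_char 1 * sl2_char n"
      using sl2_char_1_mult[of "Suc n"] by (simp add: distrib_left del: sl2_char.simps(2))
    finally show ?thesis using 2 by (simp del: sl2_char.simps(2))
  next
    case 3
    have "sl2_char (Suc m) * sl2_char (Suc n)
        = sl2_char 1 * (sl2_char (Suc (Suc k)) * sl2_char (Suc n)) - sl2_char (Suc k) * sl2_char (Suc n)"
      unfolding 3 rec[of "Suc k"] by (simp only: left_diff_distrib mult.assoc)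
    also have "\<dots> = sl2_char 1 * (sl2_char (Suc (Suc (Suc k + n))) + sl2_char (Suc k) * sl2_char n)
        - (sl2_char (Suc (Suc (k + n))) + sl2_char k * sl2_char n)"
      using less.IH[of "Suc k"] less.IH[of k] 3 by (simp del: sl2_char.simps(2))
    also have "\<dots> = (sl2_char 1 * sl2_char (Suc (Suc (Suc k + n))) - sl2_char (Suc (Suc (k + n))))
        + (sl2_char 1 * sl2_char (Suc k) - sl2_char k) * sl2_char n"
      by (simp add: algebra_simps del: sl2_char.simps(2))
    also have "\<dots> = sl2_char (Suc (Suc (m + n))) + sl2_char m * sl2_char n"
      using 3 rec[of k] rec[of "Suc (Suc (k + n))"] by (simp del: sl2_char.simps(2))
    finally show ?thesis .
  qed
qed

inductive_set cone :: "'a set" where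
  zero: "0 \<in> cone"
| add_char: "f \<in> cone \<Longrightarrow> sl2_char n + f \<in> cone"

lemma sl2_char_in_cone: "sl2_char n \<in> cone"
  using cone.add_char[OF cone.zero] by simp

lemma one_in_cone: "1 \<in> cone"
  using sl2_char_in_cone[of 0] by simp

lemma cone_add: "f \<in> cone \<Longrightarrow> g \<in> cone \<Longrightarrow> f + g \<in> cone"
  by (induction rule: cone.induct) (auto simp: add.assoc intro: cone.add_char)

lemma cone_sum: "(\<And>i. i \<in> A \<Longrightarrow> f i \<in> cone) \<Longrightarrow> sum f A \<in> cone"
  by (induction A rule: infinite_finite_induct) (auto intro: cone.zero cone_add)

lemma sl2_char_mult_in_cone: "sl2_char m * sl2_char n \<in> cone"
proof (induction m arbitrary: n)
  case 0
  then show ?case using sl2_char_in_cone by simp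
next
  case (Suc m)
  show ?case
  proof (cases n)
    case 0
    then show ?thesis using sl2_char_in_cone[of "Suc m"] by simp
  next
    case (Suc k)
    then show ?thesis using clebsch_gordan[of m k] Suc.IH[of k] by (metis cone.add_char)
  qed
qed

lemma cone_mult:
  assumes "f \<in> cone" "g \<in> cone"
  shows "f * g \<in> cone"
proof -
  have char: "sl2_char n * g \<in> cone" for n
    using assms(2)
    by (induction rule: cone.induct)
      (auto simp: distrib_left intro: cone.zero cone_add sl2_char_mult_in_cone)
  show ?thesis
    using assms(1)
    by (induction rule: cone.induct) (auto simp: distrib_right intro: cone.zero cone_add char)
qed

definition cone_fps :: "'a fps set" where
  "cone_fps = {F. \<forall>n. F $ n \<in> cone}"

lemma cone_fps_add: "F \<in> cone_fps \<Longrightarrow> G \<in> cone_fps \<Longrightarrow> F + G \<in> cone_fps"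
  by (simp add: cone_fps_def cone_add)

lemma cone_fps_mult: "F \<in> cone_fps \<Longrightarrow> G \<in> cone_fps \<Longrightarrow> F * G \<in> cone_fps"
  by (auto simp: cone_fps_def fps_mult_nth intro!: cone_sum cone_mult)

lemma zero_in_cone_fps: "0 \<in> cone_fps"
  by (simp add: cone_fps_def cone.zero)

lemma one_in_cone_fps: "1 \<in> cone_fps"
  by (simp add: cone_fps_def cone.zero one_in_cone)

lemma X_power_in_cone_fps: "fps_X ^ k \<in> cone_fps"
  by (simp add: cone_fps_def cone.zero one_in_cone fps_X_power_nth)

text \<open>The recursion of the characters turns H(1 - zu), for H the sum of all chi_n u^n, into
  the geometric series of xu. Then u = q^b is substituted.\<close>

lemma inverse_quadratic_in_cone_fps:
  assumes "b > 0"
  shows "inverse (1 - fps_const z * fps_X ^ b) * inverse (1 - fps_const x * fps_X ^ b) \<in> cone_fps"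
proof -
  define H where "H = Abs_fps sl2_char"
  define G where "G = Abs_fps (\<lambda>n. x ^ n)"
  have Hz: "H * (1 - fps_const z * fps_X) = G"
  proof (rule fps_ext)
    fix n
    have "H * (1 - fps_const z * fps_X) = H - fps_const z * (H * fps_X)"
      by (simp add: algebra_simps)
    then show "(H * (1 - fps_const z * fps_X)) $ n = G $ n"
      by (cases n) (simp_all add: H_def G_def)
  qed
  have "G * (1 - fps_const x * fps_X) = 1"
  proof (rule fps_ext)
    fix n
    have "G * (1 - fps_const x * fps_X) = G - fps_const x * (G * fps_X)"
      by (simp add: algebra_simps)
    then show "(G * (1 - fps_const x * fps_X)) $ n = 1 $ n"
      by (cases n) (simp_all add: G_def)
  qed
  with Hz have "H * (1 - fps_const z * fps_X) * (1 - fps_const x * fps_X) = 1" by simp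
  then have "(H * (1 - fps_const z * fps_X) * (1 - fps_const x * fps_X)) oo fps_X ^ b = 1"
    by simp
  moreover have X0: "(fps_X ^ b) $ 0 = (0::'a)" using assms by simp
  ultimately have "(H oo fps_X ^ b) * ((1 - fps_const z * fps_X ^ b) * (1 - fps_const x * fps_X ^ b)) = 1"
    by (simp add: fps_compose_mult_distrib fps_compose_sub_distrib mult.assoc)
  then have "inverse ((1 - fps_const z * fps_X ^ b) * (1 - fps_const x * fps_X ^ b)) = H oo fps_X ^ b"
    by (metis fps_inverse_unique mult.commute)
  moreover have "H oo fps_X ^ b \<in> cone_fps"
    by (auto simp: cone_fps_def fps_nth_compose_X_power H_def cone.zero sl2_char_in_cone)
  ultimately show ?thesis by (simp add: fps_inverse_mult)
qed

end

section \<open>The recurrence for L_k and its q-adic iteration\<close>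

locale rank_series = unit_pair z x for z x :: "'a::field" +
  fixes b :: nat and Q \<alpha> :: "'a fps"
  assumes b: "b > 0" and Q: "Q = fps_X ^ b"
    and \<alpha>: "\<alpha> \<in> cone_fps" and \<alpha>0: "\<alpha> $ 0 = 0"
begin

abbreviation Z where "Z \<equiv> fps_const z"
abbreviation Y where "Y \<equiv> fps_const x"

lemma YZ: "Y * Z = 1"
  using zx by (simp add: mult.commute)

lemma Q_power_nth_0: "(Q ^ Suc k) $ 0 = 0"
  using b by (simp add: Q)

lemma Q_power: "Q ^ k = fps_X ^ (b * k)"
  by (simp add: Q power_mult)

lemma inverse_\<alpha>: "inverse (1 - \<alpha> * Q ^ k) * (1 - \<alpha> * Q ^ k) = 1"
  by (rule inverse_mult_eq_1) (simp add: \<alpha>0)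

lemma inverse_Q: "inverse (1 - fps_const c * Q ^ Suc k) * (1 - fps_const c * Q ^ Suc k) = 1"
  by (rule inverse_mult_eq_1) (simp add: Q_power_nth_0 del: power_Suc fps_power_zeroth)

primrec B :: "nat \<Rightarrow> 'a fps" where
  "B 0 = inverse (1 - \<alpha>)"
| "B (Suc N) = B N * (1 + Y * Q ^ Suc N) * (1 + \<alpha> * Y * Q ^ N) *
     inverse (1 - Y * Q ^ Suc N) * inverse (1 - \<alpha> * Q ^ Suc N)"

text \<open>
  \<open>T k N\<close> is the \<open>N\<close>-th summand of \<open>L\<^sub>k\<close> without the factor \<open>1 - zQ\<^sup>k\<close>. The sums are cut off at \<open>M\<close>,
  because for \<open>k = 0\<close> the full sum does not converge \<open>q\<close>-adically.
\<close>

primrec T :: "nat \<Rightarrow> nat \<Rightarrow> 'a fps" where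
  "T k 0 = inverse (1 - \<alpha>)"
| "T k (Suc N) = T k N * (Z * Q ^ k) * (1 + Y * Q ^ Suc N) * (1 + \<alpha> * Y * Q ^ N) *
     inverse (1 - Y * Q ^ Suc (k + N)) * inverse (1 - \<alpha> * Q ^ Suc N)"

definition L :: "nat \<Rightarrow> nat \<Rightarrow> 'a fps" where
  "L M k = (1 - Z * Q ^ k) * (\<Sum>N<M. T k N)"

definition c :: "nat \<Rightarrow> 'a fps" where
  "c k = (1 + Q ^ k) * (\<alpha> + Q ^ Suc k) *
     (inverse (1 - Z * Q ^ Suc k) * inverse (1 - Y * Q ^ Suc k))"

lemma T_0: "T 0 N = Z ^ N * B N"
  by (induction N) (simp_all add: mult_ac del: fps_const_power)

text \<open>Passing from k to k + 1 multiplies (zQ^k)^N by Q^N and slides the product (xQ^(k+1);Q)_N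
  by one step, so only its end factors change.\<close>

lemma T_Suc_shift:
  "Q ^ N * T k N * inverse (1 - Y * Q ^ Suc (k + N)) = T (Suc k) N * inverse (1 - Y * Q ^ Suc k)"
proof (induction N)
  case 0
  then show ?case by simp
next
  case (Suc N)
  have "Q ^ Suc N * T k (Suc N) * inverse (1 - Y * Q ^ Suc (k + Suc N))
    = (Q ^ N * T k N * inverse (1 - Y * Q ^ Suc (k + N))) * (Z * Q ^ Suc k) * (1 + Y * Q ^ Suc N)
      * (1 + \<alpha> * Y * Q ^ N) * inverse (1 - Y * Q ^ Suc (Suc k + N)) * inverse (1 - \<alpha> * Q ^ Suc N)"
    by (simp add: mult_ac)
  also have "\<dots> = T (Suc k) (Suc N) * inverse (1 - Y * Q ^ Suc k)"
    unfolding Suc.IH by (simp add: mult_ac)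
  finally show ?case .
qed

text \<open>\<open>T_Suc_shift\<close> makes \<open>T k N\<close> a common factor; what remains is a
  rational identity in Q, Q^k, Q^N, \<alpha>, x and z that rests on xz = 1.\<close>

lemma telescope_step:
  "(1 - Z * Q ^ k) * T k N - (1 + Q ^ k) * (\<alpha> + Q ^ Suc k) * (T (Suc k) N * inverse (1 - Y * Q ^ Suc k))
    = T k N * (1 - \<alpha> * Q ^ N) - T k (Suc N) * (1 - \<alpha> * Q ^ Suc N)"
proof -
  define I where "I = inverse (1 - Y * Q ^ Suc (k + N))"
  define J where "J = inverse (1 - \<alpha> * Q ^ Suc N)"
  define K where "K = Q ^ k"
  define u where "u = Q ^ N"
  define t where "t = T k N"
  have I: "I * (1 - Y * (Q * (K * u))) = 1"
    using inverse_Q[of x "k + N"] by (simp add: I_def K_def u_def power_add)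
  have J: "J * (1 - \<alpha> * (Q * u)) = 1"
    using inverse_\<alpha>[of "Suc N"] by (simp add: J_def u_def)
  have "(1 - Z * K) * t - (1 + K) * (\<alpha> + Q * K) * (u * t * I)
    = t * (1 - \<alpha> * u) - t * (Z * K) * (1 + Y * (Q * u)) * (1 + \<alpha> * Y * u) * I"
    using I YZ by algebra
  also have "\<dots> = t * (1 - \<alpha> * u) - t * (Z * K) * (1 + Y * (Q * u)) * (1 + \<alpha> * Y * u) * I
      * (J * (1 - \<alpha> * (Q * u)))"
    by (simp only: J mult_1_right)
  finally show ?thesis
    unfolding T_Suc_shift[symmetric]
    by (simp add: I_def J_def K_def u_def t_def mult.assoc)
qed

lemma telescope_sum:
  "(1 - Z * Q ^ k) * (\<Sum>N<M. T k N)
    = 1 - T k M * (1 - \<alpha> * Q ^ M)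
      + (1 + Q ^ k) * (\<alpha> + Q ^ Suc k) * ((\<Sum>N<M. T (Suc k) N) * inverse (1 - Y * Q ^ Suc k))"
proof (induction M)
  case 0
  then show ?case using inverse_\<alpha>[of 0] by simp
next
  case (Suc M)
  have "A * (S + t) = 1 - g' + e * ((S' + t') * i)"
    if "A * S = 1 - g + e * (S' * i)" "A * t - e * (t' * i) = g - g'"
    for A S S' t t' g g' e i :: "'a fps"
    using that by algebra
  from this[OF Suc.IH telescope_step] show ?case by (simp only: sum.lessThan_Suc)
qed

lemma L_rec: "L M k = 1 - T k M * (1 - \<alpha> * Q ^ M) + c k * L M (Suc k)"
proof -
  have T_sum: "inverse (1 - Z * Q ^ Suc k) * L M (Suc k) = (\<Sum>N<M. T (Suc k) N)"
    unfolding L_def mult.assoc[symmetric] inverse_Q by (rule mult_1)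
  have "c k * L M (Suc k) = (1 + Q ^ k) * (\<alpha> + Q ^ Suc k) *
      ((\<Sum>N<M. T (Suc k) N) * inverse (1 - Y * Q ^ Suc k))"
    unfolding c_def T_sum[symmetric] by (simp only: mult_ac)
  then show ?thesis
    using telescope_sum[of k M] by (simp only: L_def)
qed

lemma X_dvd_c: "fps_X dvd c k"
proof -
  have "fps_X dvd \<alpha> + Q ^ Suc k"
  proof (rule dvdI)
    show "\<alpha> + Q ^ Suc k = fps_X * fps_shift 1 (\<alpha> + Q ^ Suc k)"
      by (rule fps_ext) (use \<alpha>0 Q_power_nth_0[of k] in \<open>simp del: power_Suc\<close>)
  qed
  then show ?thesis by (simp add: c_def)
qed

lemma c_in_cone: "c k \<in> cone_fps"
proof -
  have "inverse (1 - Z * Q ^ Suc k) * inverse (1 - Y * Q ^ Suc k) \<in> cone_fps"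
    unfolding Q_power using inverse_quadratic_in_cone_fps[of "b * Suc k"] b by simp
  moreover have "Q ^ j \<in> cone_fps" for j
    unfolding Q_power by (rule X_power_in_cone_fps)
  ultimately show ?thesis
    unfolding c_def by (meson cone_fps_mult cone_fps_add one_in_cone_fps \<alpha>)
qed

text \<open>Each step of the recursion contributes Q^k, which is divisible by q only for k > 0;
  hence the separate treatment of k = 0 in \<open>rank_series_in_cone\<close>.\<close>

lemma X_power_dvd_T: "k > 0 \<Longrightarrow> fps_X ^ N dvd T k N"
proof (induction N)
  case (Suc N)
  have "fps_X dvd Q ^ k" using Suc.prems b by (simp add: Q power_mult[symmetric])
  with Suc.IH[OF Suc.prems] have "fps_X ^ N * fps_X dvd T k N * Q ^ k" by (rule mult_dvd_mono)
  then have "fps_X ^ Suc N dvd T k N * Q ^ k" by (simp only: power_Suc2)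
  then have "fps_X ^ Suc N dvd (T k N * Q ^ k) * (Z * (1 + Y * Q ^ Suc N) * (1 + \<alpha> * Y * Q ^ N) *
     inverse (1 - Y * Q ^ Suc (k + N)) * inverse (1 - \<alpha> * Q ^ Suc N))"
    by (rule dvd_mult2)
  then show ?case by (simp add: mult_ac)
qed simp

text \<open>Each use of \<open>L_rec\<close> gains a factor q from c_k and passes to k + 1; the
  boundary terms vanish modulo q^M, hence modulo q^j.\<close>

lemma L_approx: "j \<le> M \<Longrightarrow> k > 0 \<Longrightarrow> \<exists>P \<in> cone_fps. fps_X ^ j dvd L M k - P"
proof (induction j arbitrary: k)
  case 0
  then show ?case using zero_in_cone_fps by auto
next
  case (Suc j)
  then obtain P where P: "P \<in> cone_fps" "fps_X ^ j dvd L M (Suc k) - P"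
    by (meson Suc_leD zero_less_Suc)
  have "fps_X ^ Suc j dvd c k * (L M (Suc k) - P)"
    using mult_dvd_mono[OF X_dvd_c P(2)] by simp
  moreover have "fps_X ^ Suc j dvd T k M * (1 - \<alpha> * Q ^ M)"
    using X_power_dvd_T[of k M] Suc.prems by (meson dvd_mult2 dvd_trans le_imp_power_dvd)
  ultimately have "fps_X ^ Suc j dvd c k * (L M (Suc k) - P) - T k M * (1 - \<alpha> * Q ^ M)"
    by (rule dvd_diff)
  then have "fps_X ^ Suc j dvd L M k - (1 + c k * P)"
    unfolding L_rec[of M k] by (simp add: algebra_simps)
  moreover have "1 + c k * P \<in> cone_fps"
    using P(1) by (intro cone_fps_mult cone_fps_add one_in_cone_fps c_in_cone)
  ultimately show ?case by blast
qed

lemma rank_series_in_cone: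
  assumes "n < M"
  shows "(Z ^ M * B M + (1 - Z) * (\<Sum>N<M. Z ^ N * B N)) $ n \<in> cone"
proof -
  let ?F = "Z ^ M * B M + (1 - Z) * (\<Sum>N<M. Z ^ N * B N)"
  obtain P where P: "P \<in> cone_fps" "fps_X ^ M dvd L M 1 - P"
    using L_approx[of M M 1] by auto
  \<comment> \<open>The boundary term z^M B_M is \<open>T 0 M\<close>. Adding it to
    \<open>L_rec\<close> at k = 0 leaves only \<open>T 0 M * \<alpha> * Q ^ M\<close>, which does
    not reach q^n for n < M.\<close>
  have "?F = T 0 M + L M 0" by (simp add: L_def T_0)
  also have "\<dots> = 1 + c 0 * L M 1 + T 0 M * \<alpha> * Q ^ M"
    unfolding L_rec[of M 0] by (simp add: algebra_simps)
  finally have "?F - (1 + c 0 * P) = c 0 * (L M 1 - P) + T 0 M * \<alpha> * Q ^ M"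
    by (simp add: algebra_simps)
  moreover have "fps_X ^ M dvd Q ^ M"
    unfolding Q using b by (intro dvd_power_same) simp
  ultimately have "fps_X ^ M dvd ?F - (1 + c 0 * P)"
    using P(2) by (metis dvd_add dvd_mult)
  then obtain E where "?F - (1 + c 0 * P) = fps_X ^ M * E" by (elim dvdE)
  then have "(?F - (1 + c 0 * P)) $ n = 0"
    using assms by (simp only: fps_X_power_mult_nth) simp
  moreover have "1 + c 0 * P \<in> cone_fps"
    using P(1) by (intro cone_fps_mult cone_fps_add one_in_cone_fps c_in_cone)
  ultimately show ?thesis by (simp add: cone_fps_def)
qed

end


section \<open>Overpartitions with bounded parts\<close>

definition overpartitions :: "overpartition set" where
  "overpartitions = {ps. overpartition_of (sum_list (map fst ps)) ps}"

lemma overpartition_of_iff: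
  "overpartition_of n ps \<longleftrightarrow> ps \<in> overpartitions \<and> sum_list (map fst ps) = n"
  by (auto simp: overpartitions_def overpartition_of_def)

lemma finite_overpartitions_sum: "finite {ps \<in> overpartitions. sum_list (map fst ps) = n}"
  using finite_overpartitions[of n] by (simp add: overpartition_of_iff)

lemma Nil_in_overpartitions: "[] \<in> overpartitions"
  by (simp add: overpartitions_def overpartition_of_def)

text \<open>The new head precedes everything, so it may be overlined freely, whereas parts of its
  size in the tail cease to be first occurrences.\<close>

lemma Cons_in_overpartitions:
  "p # ps \<in> overpartitions \<longleftrightarrow> ps \<in> overpartitions \<and> fst p > 0 \<and>
     (\<forall>r \<in> set ps. fst r \<le> fst p \<and> (snd r \<longrightarrow> fst r \<noteq> fst p))"
proof -
  have first: "(\<forall>i < length (p # ps). snd ((p # ps) ! i) \<longrightarrow> (\<forall>j < i. fst ((p # ps) ! j) \<noteq> fst ((p # ps) ! i)))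
    \<longleftrightarrow> (\<forall>i < length ps. snd (ps ! i) \<longrightarrow> (\<forall>j < i. fst (ps ! j) \<noteq> fst (ps ! i)))
        \<and> (\<forall>i < length ps. snd (ps ! i) \<longrightarrow> fst (ps ! i) \<noteq> fst p)"
    by (auto simp: All_less_Suc2)
  show ?thesis
    unfolding overpartitions_def overpartition_of_def mem_Collect_eq first
    by (auto simp: all_set_conv_all_nth)
qed

definition bounded_overpartitions :: "nat \<Rightarrow> overpartition set" where
  "bounded_overpartitions k = {ps \<in> overpartitions. \<forall>p \<in> set ps. fst p \<le> k}"

text \<open>An intermediate stage between the bounds k - 1 and k: it separates the factors for plain
  and overlined parts k, and for odd k it is a level set of the M_2-rank.\<close>

definition plain_bounded_overpartitions :: "nat \<Rightarrow> overpartition set" where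
  "plain_bounded_overpartitions k = {ps \<in> bounded_overpartitions k. (k, True) \<notin> set ps}"

lemma bounded_overpartitions_0: "bounded_overpartitions 0 = {[]}"
proof -
  have "ps = []" if "ps \<in> bounded_overpartitions 0" for ps
    using that by (cases ps) (auto simp: bounded_overpartitions_def Cons_in_overpartitions)
  then show ?thesis by (auto simp: bounded_overpartitions_def Nil_in_overpartitions)
qed

lemma plain_bounded_overpartitions_Suc:
  "plain_bounded_overpartitions (Suc k) =
     bounded_overpartitions k \<union> Cons (Suc k, False) ` plain_bounded_overpartitions (Suc k)"
  (is "?A = ?B")
proof (intro set_eqI)
  fix ps show "ps \<in> ?A \<longleftrightarrow> ps \<in> ?B"
  proof (cases ps)
    case Nil
    then show ?thesis
      by (auto simp: plain_bounded_overpartitions_def bounded_overpartitions_def Nil_in_overpartitions)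
  next
    case (Cons p qs)
    obtain j c where "p = (j, c)" by (cases p)
    with Cons show ?thesis
      by (auto simp: plain_bounded_overpartitions_def bounded_overpartitions_def
          Cons_in_overpartitions image_iff le_Suc_eq)
  qed
qed

text \<open>An overlined k + 1 is the first occurrence of the largest part, so it heads the list and
  can be removed.\<close>

lemma bounded_overpartitions_Suc:
  "bounded_overpartitions (Suc k) =
     plain_bounded_overpartitions (Suc k) \<union> Cons (Suc k, True) ` plain_bounded_overpartitions (Suc k)"
  (is "?A = ?B")
proof (intro set_eqI)
  fix ps show "ps \<in> ?A \<longleftrightarrow> ps \<in> ?B"
  proof (cases ps)
    case Nil
    then show ?thesis
      by (auto simp: plain_bounded_overpartitions_def bounded_overpartitions_def Nil_in_overpartitions)
  next
    case (Cons p qs)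
    obtain j c where "p = (j, c)" by (cases p)
    with Cons show ?thesis
      by (auto simp: plain_bounded_overpartitions_def bounded_overpartitions_def
          Cons_in_overpartitions image_iff le_Suc_eq)
  qed
qed

section \<open>Generating functions by size\<close>

definition gf :: "(overpartition \<Rightarrow> 'a::field) \<Rightarrow> overpartition set \<Rightarrow> 'a fps" where
  "gf f A = Abs_fps (\<lambda>n. \<Sum>ps | ps \<in> A \<and> sum_list (map fst ps) = n. f ps)"

lemma finite_fibre:
  "A \<subseteq> overpartitions \<Longrightarrow> finite {ps. ps \<in> A \<and> sum_list (map fst ps) = n}"
  by (rule finite_subset[OF _ finite_overpartitions_sum[of n]]) auto

lemma gf_Un:
  assumes "A \<subseteq> overpartitions" "B \<subseteq> overpartitions" "A \<inter> B = {}"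
  shows "gf f (A \<union> B) = gf f A + gf f B"
proof (rule fps_ext)
  fix n
  have "{ps. ps \<in> A \<union> B \<and> sum_list (map fst ps) = n} =
      {ps. ps \<in> A \<and> sum_list (map fst ps) = n} \<union> {ps. ps \<in> B \<and> sum_list (map fst ps) = n}"
    by auto
  then show "gf f (A \<union> B) $ n = (gf f A + gf f B) $ n"
    using assms by (auto simp: gf_def intro!: sum.union_disjoint finite_fibre)
qed

lemma gf_Cons:
  assumes "\<And>ps. f (p # ps) = w * f ps"
  shows "gf f (Cons p ` A) = fps_const w * fps_X ^ fst p * gf f A"
proof (rule fps_ext)
  fix n
  show "gf f (Cons p ` A) $ n = (fps_const w * fps_X ^ fst p * gf f A) $ n"
  proof (cases "n < fst p")
    case True
    then have "{ps. ps \<in> Cons p ` A \<and> sum_list (map fst ps) = n} = {}" by auto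
    then have "gf f (Cons p ` A) $ n = 0" unfolding gf_def fps_nth_Abs_fps by (simp only: sum.empty)
    with True show ?thesis by (simp add: mult.assoc fps_X_power_mult_nth)
  next
    case False
    then have "{ps. ps \<in> Cons p ` A \<and> sum_list (map fst ps) = n}
        = Cons p ` {ps. ps \<in> A \<and> sum_list (map fst ps) = n - fst p}" by auto
    with False show ?thesis
      by (simp add: gf_def mult.assoc fps_X_power_mult_nth sum.reindex assms sum_distrib_left)
  qed
qed

lemma gf_singleton_Nil: "gf f {[]} = fps_const (f [])"
proof (rule fps_ext)
  fix n
  have "{ps::overpartition. ps = [] \<and> sum_list (map fst ps) = n} = (if n = 0 then {[]} else {})"
    by auto
  then show "gf f {[]} $ n = fps_const (f []) $ n" by (simp add: gf_def)
qed

definition weight :: "(nat \<times> bool \<Rightarrow> 'a::field) \<Rightarrow> overpartition \<Rightarrow> 'a" where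
  "weight w ps = prod_list (map w ps)"

lemma weight_Nil [simp]: "weight w [] = 1"
  by (simp add: weight_def)

lemma weight_Cons [simp]: "weight w (p # ps) = w p * weight w ps"
  by (simp add: weight_def)

lemma gf_plain_bounded_Suc:
  fixes w :: "nat \<times> bool \<Rightarrow> 'a::field"
  shows "gf (weight w) (plain_bounded_overpartitions (Suc k)) =
     gf (weight w) (bounded_overpartitions k) *
     inverse (1 - fps_const (w (Suc k, False)) * fps_X ^ Suc k)"
proof -
  let ?v = "fps_const (w (Suc k, False)) * fps_X ^ Suc k"
  let ?P = "plain_bounded_overpartitions (Suc k)"
  have "gf (weight w) ?P = gf (weight w) (bounded_overpartitions k)
      + gf (weight w) (Cons (Suc k, False) ` ?P)"
  proof (subst plain_bounded_overpartitions_Suc, rule gf_Un)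
    show "Cons (Suc k, False) ` ?P \<subseteq> overpartitions"
      using plain_bounded_overpartitions_Suc[of k]
      by (auto simp: plain_bounded_overpartitions_def bounded_overpartitions_def)
  qed (auto simp: bounded_overpartitions_def)
  also have "gf (weight w) (Cons (Suc k, False) ` ?P) = ?v * gf (weight w) ?P"
    by (subst gf_Cons[where w = "w (Suc k, False)"]) simp_all
  finally have rec: "gf (weight w) ?P = gf (weight w) (bounded_overpartitions k) + ?v * gf (weight w) ?P" .
  have "h = g * (1 - v)" if "g = h + v * g" for g h v :: "'a fps"
  proof -
    have "g * (1 - v) = g - v * g" by (simp add: algebra_simps)
    then show ?thesis by (metis add_diff_cancel_right' that)
  qed
  from this[OF rec]
  have "gf (weight w) (bounded_overpartitions k) = gf (weight w) ?P * (1 - ?v)" .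
  moreover have "(1 - ?v) * inverse (1 - ?v) = 1"
    by (rule inverse_mult_eq_1') simp
  ultimately show ?thesis by (simp only: mult.assoc mult_1_right)
qed

lemma gf_bounded_Suc:
  "gf (weight w) (bounded_overpartitions (Suc k)) =
     gf (weight w) (plain_bounded_overpartitions (Suc k)) *
     (1 + fps_const (w (Suc k, True)) * fps_X ^ Suc k)"
proof -
  let ?u = "fps_const (w (Suc k, True)) * fps_X ^ Suc k"
  let ?P = "plain_bounded_overpartitions (Suc k)"
  have "gf (weight w) (bounded_overpartitions (Suc k)) =
      gf (weight w) ?P + gf (weight w) (Cons (Suc k, True) ` ?P)"
  proof (subst bounded_overpartitions_Suc, rule gf_Un)
    show "Cons (Suc k, True) ` ?P \<subseteq> overpartitions"
      using bounded_overpartitions_Suc[of k] by (auto simp: bounded_overpartitions_def)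
  qed (auto simp: plain_bounded_overpartitions_def bounded_overpartitions_def)
  also have "gf (weight w) (Cons (Suc k, True) ` ?P) = ?u * gf (weight w) ?P"
    by (subst gf_Cons[where w = "w (Suc k, True)"]) simp_all
  finally show ?thesis by (simp add: algebra_simps)
qed

text \<open>Summation by parts, truncated at M, in the shape that \<open>rank_series_in_cone\<close>
  expects: \<open>S (Suc M)\<close> exceeds \<open>S M\<close> by the overpartitions of level
  exactly M + 1.\<close>

lemma gf_level:
  fixes z :: "'a::field" and level :: "overpartition \<Rightarrow> nat"
  defines "S \<equiv> \<lambda>N. {ps \<in> overpartitions. level ps \<le> N}"
  shows "gf (\<lambda>ps. z ^ level ps * f ps) (S M) =
     fps_const z ^ M * gf f (S M) + (1 - fps_const z) * (\<Sum>N<M. fps_const z ^ N * gf f (S N))"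
proof (induction M)
  case 0
  have "gf (\<lambda>ps. z ^ level ps * f ps) (S 0) = gf f (S 0)"
    by (rule fps_ext) (auto simp: gf_def S_def intro!: sum.cong)
  then show ?case by simp
next
  case (Suc M)
  define D where "D = {ps \<in> overpartitions. level ps = Suc M}"
  have split: "gf g (S (Suc M)) = gf g (S M) + gf g D" for g :: "overpartition \<Rightarrow> 'a"
  proof -
    have "S (Suc M) = S M \<union> D" by (auto simp: S_def D_def)
    then show ?thesis by (simp only:) (rule gf_Un, auto simp: S_def D_def)
  qed
  have "gf (\<lambda>ps. z ^ level ps * f ps) D = fps_const z ^ Suc M * gf f D"
    unfolding fps_const_power
    by (rule fps_ext) (auto simp: gf_def D_def sum_distrib_left intro!: sum.cong)
  then show ?case using Suc.IH split[of f] split[of "\<lambda>ps. z ^ level ps * f ps"]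
    by (simp add: algebra_simps)
qed

section \<open>Coefficient comparison in Laurent series in z\<close>

interpretation laurent: unit_pair fls_X "fls_X_inv :: rat fls"
  by unfold_locales (simp add: fls_X_inv_times_conv_shift fls_X_times_conv_shift)

lemma sl2_char_nth: "laurent.sl2_char n $$ m = (if \<bar>m\<bar> \<le> int n \<and> even (int n - m) then 1 else 0)"
proof (induction n arbitrary: m)
  case 0
  then show ?case by auto
next
  case (Suc n)
  have "(fls_X * laurent.sl2_char n) $$ m = laurent.sl2_char n $$ (m - 1)" by (simp add: fls_X_times_conv_shift)
  moreover have "(fls_X_inv ^ Suc n) $$ m = (if m = - int (Suc n) then 1 else 0)"
    by (simp only: fls_X_inv_power_nth)
  moreover have "\<bar>m\<bar> \<le> int (Suc n) \<and> even (int (Suc n) - m) \<longleftrightarrow>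
      \<bar>m - 1\<bar> \<le> int n \<and> even (int n - (m - 1)) \<or> m = - int (Suc n)"
    by presburger
  moreover have "\<not> (\<bar>m - 1\<bar> \<le> int n \<and> m = - int (Suc n))" by presburger
  ultimately show ?case
    unfolding laurent.sl2_char.simps fls_plus_nth Suc.IH[of "m - 1"] by (simp del: power_Suc of_nat_Suc)
qed

text \<open>On exponents of the parity of n the coefficients of chi_n are 1 inside [-n, n] and 0
  outside, so a step outward from m >= 0 never gains. Sums inherit this.\<close>

lemma cone_nth_mono:
  assumes "f \<in> laurent.cone" "m \<ge> 0"
  shows "f $$ (m + 2) \<le> f $$ m"
  using assms(1)
proof (induction rule: laurent.cone.induct)
  case (add_char f n)
  have "laurent.sl2_char n $$ (m + 2) \<le> laurent.sl2_char n $$ m" using assms(2) by (auto simp: sl2_char_nth)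
  with add_char.IH show ?case by simp
qed simp

text \<open>The common frame for both ranks: z marks the level and 1/z each part counted by
  \<open>cnt\<close>, so the rank is the exponent of z.\<close>

lemma card_rank_mono:
  fixes level cnt :: "overpartition \<Rightarrow> nat" and w :: "nat \<times> bool \<Rightarrow> rat fls"
  assumes series: "rank_series fls_X fls_X_inv b Q \<alpha>"
    and B: "\<And>N. gf (weight w) {ps \<in> overpartitions. level ps \<le> N} = rank_series.B fls_X_inv Q \<alpha> N"
    and weight: "\<And>ps. weight w ps = fls_X_inv ^ cnt ps"
    and level: "\<And>ps. ps \<in> overpartitions \<Longrightarrow> level ps \<le> sum_list (map fst ps)"
    and rank: "\<And>ps. ps \<in> overpartitions \<Longrightarrow> rank ps = int (level ps) - int (cnt ps)"
    and m: "m \<ge> 0"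
  shows "card {ps. overpartition_of n ps \<and> rank ps = m + 2} \<le> card {ps. overpartition_of n ps \<and> rank ps = m}"
proof -
  interpret R: rank_series fls_X fls_X_inv b Q \<alpha> by (rule series)
  let ?f = "\<lambda>ps. fls_X ^ level ps * weight w ps"
  \<comment> \<open>The cutoff is \<open>Suc n\<close> because \<open>rank_series_in_cone\<close>
    asks for n < M. As the level is at most the size, no overpartition of n is lost.\<close>
  let ?F = "gf ?f {ps \<in> overpartitions. level ps \<le> Suc n}"
  have "?F $ n \<in> laurent.cone"
    using R.rank_series_in_cone[of n "Suc n"] unfolding gf_level B by simp
  moreover have "(?F $ n) $$ k = of_nat (card {ps. overpartition_of n ps \<and> rank ps = k})" for k
  proof -
    have "?F $ n = (\<Sum>ps | overpartition_of n ps. ?f ps)"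
      by (auto simp: gf_def overpartition_of_iff dest: level intro!: sum.cong)
    also have "\<dots> $$ k = (\<Sum>ps | overpartition_of n ps. ?f ps $$ k)"
      by (simp add: fls_nth_sum)
    also have "\<dots> = (\<Sum>ps | overpartition_of n ps. if rank ps = k then 1 else 0)"
    proof (rule sum.cong)
      fix ps assume "ps \<in> {ps. overpartition_of n ps}"
      then have "rank ps = int (level ps) - int (cnt ps)" by (simp add: overpartition_of_iff rank)
      moreover have "?f ps $$ k = (fls_X_inv ^ cnt ps) $$ (k - int (level ps))"
        by (simp add: weight fls_X_power_times_conv_shift)
      ultimately show "?f ps $$ k = (if rank ps = k then 1 else 0)" by auto
    qed simp
    also have "\<dots> = of_nat (card {ps. overpartition_of n ps \<and> rank ps = k})"
      using finite_overpartitions[of n] by (simp add: sum.If_cases Int_def)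
    finally show ?thesis .
  qed
  ultimately show ?thesis
    using cone_nth_mono[of "?F $ n" m] m by simp
qed

section \<open>The D-rank\<close>

lemma largest_part_le_iff:
  "ps \<in> overpartitions \<Longrightarrow> largest_part ps \<le> k \<longleftrightarrow> (\<forall>p \<in> set ps. fst p \<le> k)"
  by (cases ps) (force simp: largest_part_def Cons_in_overpartitions)+

lemma largest_part_le_sum: "largest_part ps \<le> sum_list (map fst ps)"
  by (cases ps) (simp_all add: largest_part_def)

lemma N_bar_mono:
  assumes "m \<ge> 0"
  shows "N_bar (m + 2) n \<le> N_bar m n"
  unfolding N_bar_def
proof (rule card_rank_mono[where level = largest_part and cnt = length and w = "\<lambda>_. fls_X_inv"])
  show series: "rank_series fls_X (fls_X_inv :: rat fls) 1 fps_X 0"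
    by unfold_locales (simp_all add: laurent.zero_in_cone_fps)
  interpret R: rank_series fls_X "fls_X_inv :: rat fls" 1 fps_X 0 by (rule series)
  fix N
  have "{ps \<in> overpartitions. largest_part ps \<le> N} = bounded_overpartitions N"
    unfolding bounded_overpartitions_def using largest_part_le_iff by blast
  moreover have "gf (weight (\<lambda>_. fls_X_inv)) (bounded_overpartitions N) = R.B N"
    by (induction N)
      (simp_all add: bounded_overpartitions_0 gf_singleton_Nil gf_bounded_Suc gf_plain_bounded_Suc
        mult_ac)
  ultimately show "gf (weight (\<lambda>_. fls_X_inv)) {ps \<in> overpartitions. largest_part ps \<le> N} = R.B N"
    by simp
qed (auto simp: weight_def D_rank_def largest_part_le_sum assms map_replicate_const)

section \<open>The M_2-rank\<close>

text \<open>
  The sets of overpartitions of bounded level have product generating functions only because \<open>chi\<close>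
  belongs to the level: level at most \<open>N\<close> means that all parts are at most \<open>2N + 1\<close> and that no
  \<open>2N + 1\<close> is overlined.
\<close>

definition M2_level :: "overpartition \<Rightarrow> nat" where
  "M2_level ps = (largest_part ps + 1) div 2 - nat (chi ps)"

lemma M2_level_le_iff:
  assumes "ps \<in> overpartitions"
  shows "M2_level ps \<le> N \<longleftrightarrow> ps \<in> plain_bounded_overpartitions (Suc (2 * N))"
proof (cases ps)
  case Nil
  then show ?thesis
    by (simp add: M2_level_def largest_part_def plain_bounded_overpartitions_def
        bounded_overpartitions_def Nil_in_overpartitions)
next
  case (Cons p qs)
  obtain j c where p: "p = (j, c)" by (cases p)
  \<comment> \<open>Once all parts are at most 2N + 1, an overlined 2N + 1 must be the head, so the
    head alone decides.\<close>
  have "ps \<in> plain_bounded_overpartitions (Suc (2 * N)) \<longleftrightarrow> j \<le> Suc (2 * N) \<and> (j = Suc (2 * N) \<longrightarrow> \<not> c)"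
    using assms unfolding Cons p
    by (force simp: plain_bounded_overpartitions_def bounded_overpartitions_def Cons_in_overpartitions)
  moreover have "M2_level ps = (j + 1) div 2 - (if odd j \<and> \<not> c then 1 else 0)"
    by (simp add: M2_level_def Cons p largest_part_def chi_def)
  moreover have "(j + 1) div 2 - (if odd j \<and> \<not> c then 1 else 0) \<le> N \<longleftrightarrow>
      j \<le> Suc (2 * N) \<and> (j = Suc (2 * N) \<longrightarrow> \<not> c)"
    by (cases c; cases "odd j"; simp only: simp_thms if_True if_False; presburger)
  ultimately show ?thesis by simp
qed

lemma N2_bar_mono:
  assumes "m \<ge> 0"
  shows "N2_bar (m + 2) n \<le> N2_bar m n"
  unfolding N2_bar_def
proof (rule card_rank_mono)
  \<comment> \<open>The rank adds the plain odd parts back, so they get weight 1 and all others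
    1/z.\<close>
  let ?w = "\<lambda>p. if odd (fst p) \<and> \<not> snd p then 1 else fls_X_inv :: rat fls"
  let ?cnt = "\<lambda>ps. length (filter (\<lambda>p. \<not> (odd (fst p) \<and> \<not> snd p)) ps)"
  show series: "rank_series fls_X (fls_X_inv :: rat fls) 2 (fps_X ^ 2) fps_X"
    using laurent.X_power_in_cone_fps[of 1] by unfold_locales simp_all
  interpret R: rank_series fls_X "fls_X_inv :: rat fls" 2 "fps_X ^ 2" fps_X by (rule series)
  fix N
  have "{ps \<in> overpartitions. M2_level ps \<le> N} = plain_bounded_overpartitions (Suc (2 * N))"
    using M2_level_le_iff
    by (auto simp: plain_bounded_overpartitions_def bounded_overpartitions_def)
  moreover have "gf (weight ?w) (plain_bounded_overpartitions (Suc (2 * N))) = R.B N"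
  proof (induction N)
    case 0
    then show ?case
      by (simp add: gf_plain_bounded_Suc bounded_overpartitions_0 gf_singleton_Nil)
  next
    case (Suc N)
    \<comment> \<open>The four new factors come from overlined 2N + 1, plain and overlined 2N + 2,
      and plain 2N + 3.\<close>
    have "gf (weight ?w) (plain_bounded_overpartitions (Suc (2 * Suc N))) =
        gf (weight ?w) (plain_bounded_overpartitions (Suc (2 * N))) * (1 + fps_const fls_X_inv * fps_X ^ Suc (2 * N))
        * inverse (1 - fps_const fls_X_inv * fps_X ^ Suc (Suc (2 * N))) * (1 + fps_const fls_X_inv * fps_X ^ Suc (Suc (2 * N)))
        * inverse (1 - fps_X ^ Suc (Suc (Suc (2 * N))))"
      by (simp add: gf_plain_bounded_Suc[of _ "Suc (Suc _)"] gf_bounded_Suc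
          gf_plain_bounded_Suc[of _ "Suc _"] del: power_Suc)
    also have "\<dots> = R.B (Suc N)"
      unfolding Suc.IH R.B.simps power_mult[symmetric] by (simp add: mult_ac)
    finally show ?case .
  qed
  ultimately show "gf (weight ?w) {ps \<in> overpartitions. M2_level ps \<le> N} = R.B N" by simp
  fix ps
  show "weight ?w ps = fls_X_inv ^ ?cnt ps" by (induction ps) auto
  have "M2_level ps \<le> largest_part ps" by (simp add: M2_level_def)
  then show "M2_level ps \<le> sum_list (map fst ps)" using largest_part_le_sum le_trans by blast
  have "\<lceil>real k / 2\<rceil> = int ((k + 1) div 2)" for k by linarith
  \<comment> \<open>The subtraction in \<open>M2_level\<close> never truncates: \<open>chi\<close>
    is 1 only if the largest part is odd, hence positive.\<close>
  moreover have "nat (chi ps) \<le> (largest_part ps + 1) div 2"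
    by (auto simp: chi_def largest_part_def elim!: oddE)
  moreover have "chi ps \<ge> 0" by (simp add: chi_def)
  moreover have "length ps = length (nonoverlined_odd_parts ps) + ?cnt ps"
    unfolding nonoverlined_odd_parts_def using sum_length_filter_compl by (metis length_map)
  ultimately show "M2_rank ps = int (M2_level ps) - int (?cnt ps)"
    by (simp add: M2_rank_def M2_level_def)
qed (rule assms)

theorem theorem1p5:
  fixes m :: int and n :: nat
  assumes "m \<ge> 0"
  shows "N_bar m n \<ge> N_bar (m + 2) n \<and> N2_bar m n \<ge> N2_bar (m + 2) n"
  using N_bar_mono[OF assms] N2_bar_mono[OF assms] by blast

end
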